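(* For each odd integer $n\ge 3$ there is a nonzero subtree root $\zeta_n\in\mathbb{C}$ of the star $K_{1,n-1}$, namely $$\zeta_n=-a_n\cos\left(\frac{\pi}{n-1}\right)-1+\mathrm{i}\,a_n\sin\left(\frac{\pi}{n-1}\right),$$ and these roots satisfy $$\lim_{\substack{n\to\infty\\ n\text{ odd}}}\frac{|\zeta_n|}{1+a_n}=1.$$ That is, the upper bound $1+\sqrt[n-1]{n-1}$ on the moduli of subtree roots of trees of order $n$ is asymptotically sharp as $n\to\infty$ through odd integers.
   Context: For an integer $n\ge 2$, $a_n=(n-1)^{1/(n-1)}$. The order of a tree is its number of vertices. A subtree of a tree $T$ is a nonempty connected subgraph of $T$ (equivalently, a nonempty vertex set inducing a connected subgraph). For a tree $T$ of order $n$, let $s_k(T)$ denote the number of subtrees of $T$ with exactly $k$ vertices. The subtree polynomial of $T$ is $\Phi_T(z)=\sum_{k=1}^{n}s_k(T)z^k$. The subtree roots of $T$ are the zeros in $\mathbb{C}$ of $\Phi_T(z)$. $K_{1,n-1}$ denotes the star of order $n$. *)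

theory Defs
  imports
    Complex_Main
    "HOL-Computational_Algebra.Polynomial"
    "Graph_Theory.Graph_Theory"
begin

text \<open>
  Finite simple graphs are represented by the locale \<open>graph\<close> (finite symmetric digraphs without
  loops and parallel arcs), and \<open>K_{m,n}\<close> is the library predicate \<open>complete_bipartite_digraph\<close>.
\<close>

text \<open>
  The library predicate \<open>tree\<close> cannot be used for symmetric digraphs: there every edge, traversed
  back and forth, counts as a cycle of length 2. The cycles of the underlying simple graph are
  those of length at least 3.
\<close>

definition undirected_tree :: "('a, 'b) pre_digraph \<Rightarrow> bool" where
  "undirected_tree T \<longleftrightarrow> graph T \<and> Digraph_Component.connected T \<and>
     \<not> (\<exists>p. pre_digraph.cycle T p \<and> length p \<ge> 3)"

definition subtrees :: "('a, 'b) pre_digraph \<Rightarrow> 'a set set" where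
  "subtrees T = {S. S \<subseteq> verts T \<and> S \<noteq> {} \<and> Digraph_Component.connected (T \<restriction> S)}"

definition num_subtrees :: "('a, 'b) pre_digraph \<Rightarrow> nat \<Rightarrow> nat" where
  "num_subtrees T k = card {S \<in> subtrees T. card S = k}"

definition subtree_poly :: "('a, 'b) pre_digraph \<Rightarrow> complex poly" where
  "subtree_poly T = (\<Sum>k = 1..card (verts T). monom (of_nat (num_subtrees T k)) k)"

definition is_subtree_root :: "('a, 'b) pre_digraph \<Rightarrow> complex \<Rightarrow> bool" where
  "is_subtree_root T z \<longleftrightarrow> poly (subtree_poly T) z = 0"

definition a_seq :: "nat \<Rightarrow> real" where
  "a_seq n = root (n - 1) (real n - 1)"

definition zeta_seq :: "nat \<Rightarrow> complex" where
  "zeta_seq n = - complex_of_real (a_seq n * cos (pi / (real n - 1))) - 1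
     + \<i> * complex_of_real (a_seq n * sin (pi / (real n - 1)))"

definition odd_at_top :: "nat filter" where
  "odd_at_top = inf at_top (principal {n. odd n})"

text \<open>Every star has a representative on the natural numbers.\<close>

lemma star_exists:
  assumes "n \<ge> 1"
  shows "\<exists>T :: (nat, nat \<times> nat) pre_digraph. K\<^bsub>1, n - 1\<^esub> T \<and> card (verts T) = n"
proof -
  let ?G = "\<lparr> pverts = {0..<n}, parcs = {0} \<times> {1..<n} \<union> {1..<n} \<times> {0} \<rparr> :: nat pair_pre_digraph"
  have "{0..<n} = {0} \<union> {1..<n}" "{0} \<inter> {1..<n} = {}" "card {1..<n} = n - 1"
    using assms by auto
  then have "K\<^bsub>1, n - 1\<^esub> (with_proj ?G)"
    unfolding complete_bipartite_digraph_pair_def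
    by (intro conjI exI[of _ "{0}"] exI[of _ "{1..<n}"]) auto
  then show ?thesis
    by (intro exI[of _ "with_proj ?G"]) simp
qed

end

theory Submission
  imports Defs
begin

text \<open>
  In the star with centre \<open>c\<close> and \<open>m = n - 1\<close> leaves, a subtree is either \<open>c\<close> together with an
  arbitrary set of leaves, or a single leaf. The binomial theorem turns this into
  \<open>\<Phi>(z) = z * (1 + z)^m + m * z\<close> (\<open>poly_subtree_poly_star\<close>), so the nonzero subtree roots are
  the solutions of \<open>(1 + z)^m = - m\<close>. For even \<open>m\<close> one of them is
  \<open>1 + z = - a_n * cis (- \<pi> / m)\<close>, because \<open>a_n^m = m\<close>, \<open>(- 1)^m = 1\<close> and \<open>cis (- \<pi>) = - 1\<close>;
  this \<open>z\<close> is \<open>\<zeta>_n\<close> (\<open>one_plus_zeta_power\<close>).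

  As \<open>n\<close> grows, \<open>a_n\<close> tends to 1 and the angle \<open>\<pi> / m\<close> to 0, so \<open>\<zeta>_n\<close> tends to \<open>- 2\<close> while
  \<open>1 + a_n\<close> tends to 2: the ratio of the moduli tends to 1. The stars, being trees, therefore
  come within any factor \<open>1 - \<epsilon>\<close> of the bound.
\<close>

section \<open>Subtree polynomials as sums over subtrees\<close>

lemma poly_subtree_poly:
  assumes "finite (verts T)"
  shows "poly (subtree_poly T) z = (\<Sum>S\<in>subtrees T. z ^ card S)"
proof -
  let ?I = "{1..card (verts T)}"
  have fin: "finite (subtrees T)"
    using assms by (auto simp: subtrees_def intro: finite_subset[of _ "Pow (verts T)"])
  have range: "card S \<in> ?I" if "S \<in> subtrees T" for S
  proof -
    have "S \<subseteq> verts T" "S \<noteq> {}" using that by (auto simp: subtrees_def)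
    then show ?thesis
      using assms by (auto simp: card_mono Suc_le_eq card_gt_0_iff finite_subset)
  qed
  have "(\<Sum>S\<in>subtrees T. z ^ card S) = (\<Sum>k\<in>?I. \<Sum>S\<in>{S \<in> subtrees T. card S = k}. z ^ card S)"
    using range by (intro sum.group[symmetric] fin) auto
  also have "\<dots> = (\<Sum>k\<in>?I. of_nat (num_subtrees T k) * z ^ k)"
    by (intro sum.cong) (auto simp: num_subtrees_def)
  finally show ?thesis
    by (simp add: subtree_poly_def poly_sum poly_monom)
qed

lemma sum_power_card_Pow:
  fixes z :: "'a::comm_ring_1"
  assumes "finite A"
  shows "(\<Sum>X\<in>Pow A. z ^ card X) = (1 + z) ^ card A"
  using prod_add[OF assms, of "\<lambda>_. z" "\<lambda>_. 1"] by (simp add: add.commute)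

section \<open>Stars\<close>

locale star = graph T for T :: "('a, 'b) pre_digraph" +
  fixes c :: 'a and V :: "'a set"
  assumes verts_eq: "verts T = insert c V"
    and centre_not_leaf: "c \<notin> V"
    and edges_eq: "arcs_ends T = {c} \<times> V \<union> V \<times> {c}"

lemma star_of_complete_bipartite:
  assumes "K\<^bsub>1, m\<^esub> T"
  obtains c V where "star T c V" "card V = m"
proof -
  from assms obtain U V where UV: "graph T" "verts T = U \<union> V" "U \<inter> V = {}" "card U = 1"
    "card V = m" "arcs_ends T = U \<times> V \<union> V \<times> U"
    unfolding complete_bipartite_digraph_def by blast
  from \<open>card U = 1\<close> obtain c where "U = {c}" by (auto simp: card_1_singleton_iff)
  with UV have "star T c V"
    by (intro star.intro star_axioms.intro) auto
  with that UV show ?thesis by blast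
qed

context star
begin

lemma finite_leaves: "finite V"
  using finite_verts by (simp add: verts_eq)

lemma arc_cases:
  assumes "e \<in> arcs T"
  obtains "tail T e = c" "head T e \<in> V" | "tail T e \<in> V" "head T e = c"
proof -
  have "(tail T e, head T e) \<in> arcs_ends T"
    using assms by (auto simp: arcs_ends_conv)
  then show ?thesis using that by (auto simp: edges_eq)
qed

text \<open>
  Any two vertices are joined through the centre; once the centre is removed, no edge is left.
\<close>
lemma connected_induced_iff:
  assumes S: "S \<subseteq> verts T"
  shows "Digraph_Component.connected (T \<restriction> S) \<longleftrightarrow> c \<in> S \<or> (\<exists>v\<in>V. S = {v})"
proof -
  have ends: "(arcs_ends (T \<restriction> S))\<^sup>s = arcs_ends T \<inter> S \<times> S"
  proof -
    have "arcs_ends (T \<restriction> S) = arcs_ends T \<inter> S \<times> S"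
      by (auto simp: arcs_ends_conv)
    then show ?thesis by (auto simp: symcl_def edges_eq)
  qed
  have conn: "Digraph_Component.connected (T \<restriction> S) \<longleftrightarrow>
      S \<noteq> {} \<and> (\<forall>u\<in>S. \<forall>v\<in>S. (u, v) \<in> rtrancl_on S (arcs_ends T \<inter> S \<times> S))"
    by (simp add: connected_conv ends)
  show ?thesis
  proof (cases "c \<in> S")
    case True
    have "(u, c) \<in> rtrancl_on S (arcs_ends T \<inter> S \<times> S)"
         "(c, u) \<in> rtrancl_on S (arcs_ends T \<inter> S \<times> S)" if "u \<in> S" for u
    proof -
      have "u = c \<or> (u, c) \<in> arcs_ends T \<inter> S \<times> S \<and> (c, u) \<in> arcs_ends T \<inter> S \<times> S"
        using that S True by (auto simp: verts_eq edges_eq)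
      then show "(u, c) \<in> rtrancl_on S (arcs_ends T \<inter> S \<times> S)"
         "(c, u) \<in> rtrancl_on S (arcs_ends T \<inter> S \<times> S)"
        using that True by (auto intro: rtrancl_on_into_rtrancl_on)
    qed
    then show ?thesis
      using True unfolding conn by (blast intro: rtrancl_on_trans)
  next
    case False
    then have "arcs_ends T \<inter> S \<times> S = {}"
      by (auto simp: edges_eq)
    moreover have "(u, v) \<in> rtrancl_on S {} \<longleftrightarrow> u = v \<and> u \<in> S" for u v
    proof
      assume "(u, v) \<in> rtrancl_on S {}"
      then show "u = v \<and> u \<in> S" by induct auto
    qed auto
    ultimately have "Digraph_Component.connected (T \<restriction> S) \<longleftrightarrow> (\<exists>v. S = {v})"
      unfolding conn by (simp only: simp_thms) blast
    then show ?thesis using False S by (auto simp: verts_eq)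
  qed
qed

lemma subtrees_eq: "subtrees T = insert c ` Pow V \<union> (\<lambda>v. {v}) ` V"
proof -
  have "S \<subseteq> verts T \<and> c \<in> S \<longleftrightarrow> S \<in> insert c ` Pow V" for S
  proof
    assume "S \<subseteq> verts T \<and> c \<in> S"
    then have "S = insert c (S - {c})" "S - {c} \<in> Pow V"
      by (auto simp: verts_eq)
    then show "S \<in> insert c ` Pow V" by (rule image_eqI)
  qed (auto simp: verts_eq)
  then have "S \<in> subtrees T \<longleftrightarrow> S \<in> insert c ` Pow V \<union> (\<lambda>v. {v}) ` V" for S
    unfolding subtrees_def using connected_induced_iff[of S] verts_eq by blast
  then show ?thesis by blast
qed

lemma poly_subtree_poly_star:
  "poly (subtree_poly T) z = z * (1 + z) ^ card V + of_nat (card V) * z"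
proof -
  have card_insert_centre: "card (insert c A) = Suc (card A)" if "A \<subseteq> V" for A
    using that centre_not_leaf finite_leaves
    by (auto simp: card_insert_if finite_subset)
  have inj: "inj_on (insert c) (Pow V)"
    using centre_not_leaf by (auto simp: inj_on_def)
  have "poly (subtree_poly T) z =
      (\<Sum>S\<in>insert c ` Pow V. z ^ card S) + (\<Sum>S\<in>(\<lambda>v. {v}) ` V. z ^ card S)"
    unfolding poly_subtree_poly[OF finite_verts] subtrees_eq
    using centre_not_leaf finite_leaves by (intro sum.union_disjoint) auto
  also have "(\<Sum>S\<in>insert c ` Pow V. z ^ card S) = (\<Sum>A\<in>Pow V. z * z ^ card A)"
    using card_insert_centre by (simp add: sum.reindex[OF inj])
  also have "\<dots> = z * (1 + z) ^ card V"
    by (simp add: sum_power_card_Pow[OF finite_leaves] flip: sum_distrib_left)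
  also have "(\<Sum>S\<in>(\<lambda>v. {v}) ` V. z ^ card S) = of_nat (card V) * z"
    by (subst sum.reindex) (auto simp: inj_on_def)
  finally show ?thesis .
qed

text \<open>
  Consecutive arcs of a walk in a star alternate between leaving and entering the centre, so
  among three of them either the first and the third enter the centre, or only the second does.
  In the second case the walk starts at the centre and its first three arcs end at a leaf: it is
  not closed there, and a fourth arc would enter the centre again.
\<close>
lemma no_long_cycle:
  assumes "cycle p" "length p \<ge> 3"
  shows False
proof -
  from assms obtain e1 e2 e3 q where p: "p = e1 # e2 # e3 # q"
    by (metis One_nat_def Suc_le_length_iff numeral_3_eq_3)
  from assms obtain u where u: "awalk u p u" "distinct (tl (awalk_verts u p))"
    by (auto simp: cycle_def)
  have heads: "tl (awalk_verts u p) = map (head T) p"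
    using awalk_verts_conv'[of u p u] u p by (auto simp: awalk_def)
  have arcs: "e \<in> arcs T" if "e \<in> set p" for e
    using u that by (auto simp: awalk_def)
  have links: "tail T e1 = u" "tail T e2 = head T e1" "tail T e3 = head T e2"
    "cas (head T e3) q u"
    using u p by (auto simp: awalk_def)
  have dist: "distinct (map (head T) p)" using u heads by simp
  have e: "e1 \<in> arcs T" "e2 \<in> arcs T" "e3 \<in> arcs T" using arcs p by auto
  show False
  proof (cases "head T e1 = c")
    case True
    have "head T e2 \<in> V" using arc_cases[OF e(2)] links True centre_not_leaf by metis
    then have "head T e3 = c" using arc_cases[OF e(3)] links centre_not_leaf by metis
    then show False using dist p True by auto
  next
    case False
    then have 1: "u = c" "head T e1 \<in> V" using arc_cases[OF e(1)] links by metis+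
    then have 2: "head T e2 = c" using arc_cases[OF e(2)] links centre_not_leaf by metis
    then have 3: "head T e3 \<in> V" using arc_cases[OF e(3)] links centre_not_leaf by metis
    show False
    proof (cases q)
      case Nil
      then show False using links 1 3 centre_not_leaf by auto
    next
      case (Cons e4 q')
      then have "e4 \<in> arcs T" "tail T e4 = head T e3" using arcs p links by auto
      then have "head T e4 = c" using arc_cases[of e4] 3 centre_not_leaf by metis
      then show False using dist p Cons 2 by auto
    qed
  qed
qed

lemma undirected_tree_star: "undirected_tree T"
proof -
  have "T \<restriction> verts T = T"
  proof -
    have "{e \<in> arcs T. tail T e \<in> verts T \<and> head T e \<in> verts T} = arcs T" by auto
    then show ?thesis by (simp add: induce_subgraph_def)
  qed
  then have "Digraph_Component.connected T"
    using connected_induced_iff[of "verts T"] by (simp add: verts_eq)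
  moreover have "graph T" by unfold_locales
  ultimately show ?thesis
    using no_long_cycle by (auto simp: undirected_tree_def)
qed

end

section \<open>The root\<close>

lemma zeta_seq_cis:
  "1 + zeta_seq n = - (complex_of_real (a_seq n) * cis (- (pi / (real n - 1))))"
  by (simp add: zeta_seq_def complex_eq_iff)

text \<open>Evenness of \<open>n - 1\<close> is what absorbs the sign of \<open>1 + \<zeta>_n\<close>.\<close>
lemma one_plus_zeta_power:
  assumes "n \<ge> 3" "odd n"
  shows "(1 + zeta_seq n) ^ (n - 1) = - of_nat (n - 1)"
proof -
  have "a_seq n ^ (n - 1) = real (n - 1)"
    using assms by (simp add: a_seq_def of_nat_diff)
  moreover have "cis (- (pi / (real n - 1))) ^ (n - 1) = - 1"
  proof -
    have "cis (- (pi / (real n - 1))) ^ (n - 1) = cis (real (n - 1) * - (pi / (real n - 1)))"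
      by (rule Complex.DeMoivre)
    also have "real (n - 1) * - (pi / (real n - 1)) = - pi"
      using assms by (simp add: of_nat_diff field_simps)
    finally show ?thesis by (simp add: complex_eq_iff)
  qed
  moreover have "even (n - 1)" using assms by simp
  ultimately show ?thesis
    unfolding zeta_seq_cis
    by (simp add: power_mult_distrib flip: of_real_power)
qed

lemma zeta_seq_nonzero:
  assumes "n \<ge> 3"
  shows "zeta_seq n \<noteq> 0"
proof -
  have "0 < pi / (real n - 1)" "pi / (real n - 1) < pi"
    using assms by (auto simp: field_simps)
  then have "sin (pi / (real n - 1)) > 0" by (rule sin_gt_zero)
  moreover have "a_seq n > 0"
    using assms by (simp add: a_seq_def)
  ultimately have "Im (zeta_seq n) > 0"
    by (simp add: zeta_seq_def)
  then show ?thesis by auto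
qed

lemma star_root:
  assumes "n \<ge> 3" "odd n" "K\<^bsub>1, n - 1\<^esub> T"
  shows "is_subtree_root T (zeta_seq n)"
proof -
  obtain c V where "star T c V" "card V = n - 1"
    using star_of_complete_bipartite[OF assms(3)] .
  then show ?thesis
    using one_plus_zeta_power[OF assms(1,2)]
    by (simp add: is_subtree_root_def star.poly_subtree_poly_star)
qed

lemma star_undirected_tree:
  assumes "K\<^bsub>1, m\<^esub> T"
  shows "undirected_tree T"
  using star_of_complete_bipartite[OF assms] star.undirected_tree_star by metis

section \<open>Asymptotics\<close>

lemma a_seq_tendsto: "a_seq \<longlonglongrightarrow> 1"
proof -
  have "a_seq (Suc m) = root m (real m)" for m
    by (simp add: a_seq_def)
  then have "(\<lambda>m. a_seq (Suc m)) \<longlonglongrightarrow> 1"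
    using LIMSEQ_root by simp
  then show ?thesis by (rule LIMSEQ_imp_Suc)
qed

lemma zeta_seq_tendsto: "zeta_seq \<longlonglongrightarrow> - 2"
proof -
  have "(\<lambda>m. pi / (real (Suc m) - 1)) \<longlonglongrightarrow> 0"
    by (simp add: lim_const_over_n)
  then have angle: "(\<lambda>n. pi / (real n - 1)) \<longlonglongrightarrow> 0"
    by (rule LIMSEQ_imp_Suc)
  have "(\<lambda>n. - complex_of_real (a_seq n * cos (pi / (real n - 1))) - 1
     + \<i> * complex_of_real (a_seq n * sin (pi / (real n - 1)))) \<longlonglongrightarrow>
     - complex_of_real (1 * cos 0) - 1 + \<i> * complex_of_real (1 * sin 0)"
    by (intro tendsto_intros a_seq_tendsto angle)
  then show ?thesis by (simp add: zeta_seq_def[abs_def])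
qed

lemma modulus_ratio_tendsto:
  "((\<lambda>n. cmod (zeta_seq n) / (1 + a_seq n)) \<longlongrightarrow> 1) odd_at_top"
proof -
  have "(\<lambda>n. cmod (zeta_seq n) / (1 + a_seq n)) \<longlonglongrightarrow> cmod (- 2) / (1 + 1)"
    by (intro tendsto_intros zeta_seq_tendsto a_seq_tendsto) simp
  then have "(\<lambda>n. cmod (zeta_seq n) / (1 + a_seq n)) \<longlonglongrightarrow> 1"
    by simp
  then show ?thesis
    unfolding odd_at_top_def by (rule tendsto_mono[rotated]) simp
qed

theorem mainTheorem3:
  shows "(\<forall>n\<ge>3. odd n \<longrightarrow>
            (\<forall>T :: ('a, 'b) pre_digraph. K\<^bsub>1, n - 1\<^esub> T \<longrightarrow>
               zeta_seq n \<noteq> 0 \<and> is_subtree_root T (zeta_seq n)))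
       \<and> ((\<lambda>n. cmod (zeta_seq n) / (1 + a_seq n)) \<longlongrightarrow> 1) odd_at_top
       \<and> (\<forall>\<epsilon>>0. \<forall>\<^sub>F n in odd_at_top.
            \<exists>(T :: (nat, nat \<times> nat) pre_digraph) z.
              undirected_tree T \<and> card (verts T) = n \<and> is_subtree_root T z \<and>
              cmod z > (1 - \<epsilon>) * (1 + a_seq n))"
proof (intro conjI allI impI)
  fix \<epsilon> :: real
  assume "\<epsilon> > 0"
  then have "\<forall>\<^sub>F n in odd_at_top. 1 - \<epsilon> < cmod (zeta_seq n) / (1 + a_seq n)"
    by (intro order_tendstoD(1)[OF modulus_ratio_tendsto]) simp
  moreover have "\<forall>\<^sub>F n in odd_at_top. n \<ge> 3 \<and> odd n"
    unfolding odd_at_top_def eventually_inf_principal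
    by (rule eventually_mono[OF eventually_ge_at_top[of 3]]) simp
  ultimately show "\<forall>\<^sub>F n in odd_at_top.
            \<exists>(T :: (nat, nat \<times> nat) pre_digraph) z.
              undirected_tree T \<and> card (verts T) = n \<and> is_subtree_root T z \<and>
              cmod z > (1 - \<epsilon>) * (1 + a_seq n)"
  proof eventually_elim
    case (elim n)
    then obtain T :: "(nat, nat \<times> nat) pre_digraph"
      where T: "K\<^bsub>1, n - 1\<^esub> T" "card (verts T) = n"
      using star_exists[of n] by auto
    have "a_seq n > 0" using elim by (simp add: a_seq_def)
    then have "cmod (zeta_seq n) > (1 - \<epsilon>) * (1 + a_seq n)"
      using elim by (simp add: pos_less_divide_eq)
    then show ?case
      using T elim star_root star_undirected_tree by blast
  qed
qed (auto simp: zeta_seq_nonzero star_root modulus_ratio_tendsto)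

end
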